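(* For every sufficiently large positive integer $m$ there exists a $(6m,4m,3m,5.05)$-concentrator.
   Context: For positive integers $m,p,q$ and a positive real number $r$, an $(m,p,q,r)$-concentrator is a bipartite graph with $m$ inputs (the vertices of one part) and $p$ outputs (the vertices of the other part), with not more than $mr$ edges, such that for any set of $k\le q$ inputs there exist $k$ pairwise disjoint edges joining these $k$ inputs to some $k$ outputs (i.e., the given set of $k$ inputs can be matched into the outputs). *)

theory Defs
  imports Complex_Main
begin

text \<open>
  A bipartite graph is given by its inputs \<open>X\<close>, its outputs \<open>Y\<close> and its edges
  \<open>E \<subseteq> X \<times> Y\<close>. An edge is an input-output pair, so the two parts count as disjoint
  even if \<open>X\<close> and \<open>Y\<close> happen to share elements (as for sets of natural numbers).
\<close>

definition disjoint_edges :: "'a \<times> 'b \<Rightarrow> 'a \<times> 'b \<Rightarrow> bool" where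
  "disjoint_edges e f \<longleftrightarrow> fst e \<noteq> fst f \<and> snd e \<noteq> snd f"

definition concentrator ::
    "nat \<Rightarrow> nat \<Rightarrow> nat \<Rightarrow> real \<Rightarrow> 'a set \<Rightarrow> 'b set \<Rightarrow> ('a \<times> 'b) set \<Rightarrow> bool" where
  "concentrator m p q r X Y E \<longleftrightarrow>
     0 < m \<and> 0 < p \<and> 0 < q \<and> 0 < r \<and>
     finite X \<and> card X = m \<and> finite Y \<and> card Y = p \<and>
     E \<subseteq> X \<times> Y \<and> real (card E) \<le> real m * r \<and>
     (\<forall>S. S \<subseteq> X \<and> card S \<le> q \<longrightarrow>
        (\<exists>M. M \<subseteq> E \<and> card M = card S \<and> fst ` M = S \<and> pairwise disjoint_edges M))"

end

theory Submission
  imports Defs "HOL-Combinatorics.Permutations"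
begin

text \<open>
  Give every input five slots, half of the outputs eight and the other half seven slots,
  so that both sides have \<open>30 m\<close> slots, and join the slots by a random permutation. By Hall's
  theorem a failure yields, for some \<open>k \<le> 3 m\<close>, a set \<open>T\<close> of \<open>k\<close> outputs containing all
  neighbours of at least \<open>k\<close> inputs. For fixed \<open>T\<close> with \<open>b\<close> slots the \<open>j\<close>-th factorial moment of the
  number of such inputs bounds the probability of this by
  \<open>(6m choose j) (b choose 5j) / ((k choose j) (30m choose 5j))\<close> for every \<open>j \<le> k\<close>. The plain
  union bound \<open>j = k\<close> just fails at \<open>k = 3 m\<close>, but
  \<open>j = k - m div 8\<close> succeeds there. For \<open>k \<le> m\<close> crude estimates with \<open>j = k\<close> give \<open>(3/10)^k\<close>. For
  \<open>m \<le> k \<le> 3 m\<close> the bound, summed over \<open>T\<close> by exponential tilting, is log-convex in \<open>k\<close>, so only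
  the two end points matter, and there it is exponentially small.
\<close>

section \<open>Hall's theorem\<close>

text \<open>Induction on the size of \<open>I\<close>. If some nonempty proper \<open>J\<close> is
  tight, having exactly \<open>card J\<close> neighbours, then \<open>J\<close> and
  \<open>I - J\<close> are matched separately. Otherwise every nonempty proper subset has a
  neighbour to spare, and an arbitrary pair can be matched and removed.\<close>

lemma hall_marriage:
  assumes "finite I" "\<And>i. i \<in> I \<Longrightarrow> finite (A i)"
    and "\<And>J. J \<subseteq> I \<Longrightarrow> card J \<le> card (\<Union>(A ` J))"
  shows "\<exists>h. inj_on h I \<and> (\<forall>i\<in>I. h i \<in> A i)"
  using assms
proof (induction "card I" arbitrary: I A rule: less_induct)
  case less
  note fin = less.prems(1) and finA = less.prems(2) and hall = less.prems(3)
  consider "I = {}" | J where "J \<subset> I" "J \<noteq> {}" "card (\<Union>(A ` J)) = card J"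
    | "I \<noteq> {}" "\<And>J. J \<subset> I \<Longrightarrow> J \<noteq> {} \<Longrightarrow> card J < card (\<Union>(A ` J))"
    using hall by (metis nless_le psubset_imp_subset)
  then show ?case
  proof cases
    case 1
    then show ?thesis by simp
  next
    case 2
    have finJ: "finite J" using 2 fin finite_subset by blast
    have fU: "finite (\<Union>(A ` L))" if "L \<subseteq> I" for L
      using that finA fin finite_subset by blast
    have "card J < card I" using 2 fin psubset_card_mono by blast
    then obtain h1 where h1: "inj_on h1 J" "\<forall>i\<in>J. h1 i \<in> A i"
    proof -
      have "\<exists>h. inj_on h J \<and> (\<forall>i\<in>J. h i \<in> A i)"
      proof (rule less.hyps[OF _ finJ])
        show "card J < card I" by fact
        show "finite (A i)" if "i \<in> J" for i using finA 2 that by blast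
        show "card L \<le> card (\<Union>(A ` L))" if "L \<subseteq> J" for L using hall 2 that by blast
      qed
      then show thesis using that by blast
    qed
    have c2: "card (I - J) < card I"
      using 2 fin by (intro psubset_card_mono) auto
    \<comment> \<open>Hall's condition for \<open>J \<union> L\<close>, minus the tight
      \<open>J\<close>, gives it for \<open>L\<close> once the neighbours of \<open>J\<close> are
      taken away.\<close>
    have hall2: "card L \<le> card (\<Union>((\<lambda>i. A i - \<Union>(A ` J)) ` L))" if L: "L \<subseteq> I - J" for L
    proof -
      have sub: "J \<union> L \<subseteq> I" using L 2 by auto
      have finL: "finite L" using L fin finite_subset by blast
      have eq: "\<Union>((\<lambda>i. A i - \<Union>(A ` J)) ` L) = \<Union>(A ` (J \<union> L)) - \<Union>(A ` J)" by auto
      have "card (\<Union>(A ` (J \<union> L)) - \<Union>(A ` J)) = card (\<Union>(A ` (J \<union> L))) - card (\<Union>(A ` J))"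
        using 2 by (intro card_Diff_subset fU) auto
      moreover have "card (J \<union> L) = card J + card L"
        using L finL finJ by (intro card_Un_disjoint) auto
      ultimately show ?thesis using hall[OF sub] 2 eq by simp
    qed
    have "\<exists>h. inj_on h (I - J) \<and> (\<forall>i\<in>I-J. h i \<in> A i - \<Union>(A ` J))"
    proof (rule less.hyps[OF c2])
      show "finite (I - J)" using fin by simp
      show "finite (A i - \<Union>(A ` J))" if "i \<in> I - J" for i using finA that by blast
    qed (rule hall2)
    then obtain h2 where h2: "inj_on h2 (I - J)" "\<forall>i\<in>I-J. h2 i \<in> A i - \<Union>(A ` J)"
      by (elim exE conjE)
    let ?h = "\<lambda>i. if i \<in> J then h1 i else h2 i"
    have "inj_on ?h I"
    proof -
      define W where "W = \<Union>(A ` J)"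
      have "h1 ` J \<subseteq> W" using h1(2) unfolding W_def by blast
      moreover have "h2 ` (I - J) \<inter> W = {}" using h2(2) unfolding W_def[symmetric] by blast
      ultimately have "h1 ` J \<inter> h2 ` (I - J) = {}" by blast
      then have "inj_on ?h (J \<union> (I - J))" using h1 h2 by (intro inj_on_disjoint_Un) auto
      moreover have "J \<union> (I - J) = I" using 2 by auto
      ultimately show ?thesis by simp
    qed
    moreover have "\<forall>i\<in>I. ?h i \<in> A i" using h1(2) h2(2) by (metis DiffD1 DiffI)
    ultimately show ?thesis by blast
  next
    case 3
    then obtain i where i: "i \<in> I" by blast
    have "card {i} \<le> card (A i)" using hall[of "{i}"] i by simp
    then obtain y where y: "y \<in> A i" by fastforce
    have c: "card (I - {i}) < card I" using i fin by (meson card_Diff1_less)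
    \<comment> \<open>Deleting \<open>y\<close> costs at most one neighbour, which the strict
      inequality absorbs.\<close>
    have hall2: "card L \<le> card (\<Union>((\<lambda>i. A i - {y}) ` L))" if L: "L \<subseteq> I - {i}" for L
    proof (cases "L = {}")
      case False
      have "L \<subset> I" using L i by auto
      then have "card L < card (\<Union>(A ` L))" using 3 False by blast
      moreover have "\<Union>((\<lambda>i. A i - {y}) ` L) = \<Union>(A ` L) - {y}" by auto
      moreover have "card (\<Union>(A ` L)) - 1 \<le> card (\<Union>(A ` L) - {y})"
        by (simp add: card_Diff_singleton_if)
      ultimately show ?thesis by (simp only:)
    qed simp
    have "\<exists>h. inj_on h (I - {i}) \<and> (\<forall>x\<in>I-{i}. h x \<in> A x - {y})"
    proof (rule less.hyps[OF c])
      show "finite (I - {i})" using fin by simp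
      show "finite (A x - {y})" if "x \<in> I - {i}" for x using finA that by blast
    qed (rule hall2)
    then obtain h where h: "inj_on h (I - {i})" "\<forall>x\<in>I-{i}. h x \<in> A x - {y}"
      by (elim exE conjE)
    have "inj_on (h(i := y)) I"
      using h by (auto simp: inj_on_def)
    moreover have "\<forall>x\<in>I. (h(i := y)) x \<in> A x" using h y by auto
    ultimately show ?thesis by blast
  qed
qed

section \<open>Counting permutations\<close>

lemma permutes_image_exists:
  assumes "finite U" "A \<subseteq> U" "C \<subseteq> U" "card A = card C"
  shows "\<exists>q. q permutes U \<and> q ` A = C"
proof -
  have fin: "finite A" "finite C" using assms finite_subset by auto
  obtain f where f: "bij_betw f A C"
    using fin assms(4) by (metis finite_same_card_bij)
  have "card (U - A) = card (U - C)"
    using assms fin by (simp add: card_Diff_subset)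
  then obtain g where g: "bij_betw g (U - A) (U - C)"
    using assms(1) by (metis finite_Diff finite_same_card_bij)
  define q where "q x = (if x \<in> A then f x else if x \<in> U then g x else x)" for x
  have "bij_betw q A C" using f by (rule bij_betw_cong[THEN iffD1, rotated]) (simp add: q_def)
  moreover have "bij_betw q (U - A) (U - C)"
    using g by (rule bij_betw_cong[THEN iffD1, rotated]) (simp add: q_def)
  ultimately have "bij_betw q (A \<union> (U - A)) (C \<union> (U - C))"
    by (rule bij_betw_combine) auto
  then have "bij_betw q U U" using assms by (simp add: Un_absorb1)
  then have "q permutes U"
    by (rule bij_imp_permutes) (use assms in \<open>auto simp: q_def\<close>)
  moreover have "q ` A = C" using \<open>bij_betw q A C\<close> by (simp add: bij_betw_def)
  ultimately show ?thesis by blast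
qed

text \<open>Under a uniform random permutation every subset of \<open>U\<close> of the right size is
  equally likely to be the image of \<open>A\<close>, because composing with a fixed permutation
  carries one image to another. The probability of landing in \<open>B\<close> is thus a quotient of
  binomial coefficients, cleared here of denominators.\<close>

lemma card_permutes_image_subset:
  assumes U: "finite U" and A: "A \<subseteq> U" and B: "B \<subseteq> U"
  shows "card {p. p permutes U \<and> p ` A \<subseteq> B} * (card U choose card A)
           = fact (card U) * (card B choose card A)"
proof -
  let ?N = "card {p. p permutes U \<and> p ` A = A}"
  have eqN: "card {p. p permutes U \<and> p ` A = C} = ?N" if C: "C \<subseteq> U" "card C = card A" for C
  proof -
    obtain q where q: "q permutes U" "q ` A = C"
      using permutes_image_exists[OF U A C(1)] C(2) by metis
    have iq: "inv q ` C = A"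
      using q by (metis image_inv_f_f permutes_inj)
    have "bij_betw (\<lambda>p. q \<circ> p) {p. p permutes U \<and> p ` A = A} {p. p permutes U \<and> p ` A = C}"
    proof (rule bij_betwI[where g = "\<lambda>p. inv q \<circ> p"])
      have comp: "(f \<circ> p) ` A = f ` (p ` A)" for f p :: "'a \<Rightarrow> 'a"
        by (rule image_comp[symmetric])
      show "(\<lambda>p. q \<circ> p) \<in> {p. p permutes U \<and> p ` A = A} \<rightarrow> {p. p permutes U \<and> p ` A = C}"
        using q by (simp add: Pi_iff permutes_compose comp del: o_apply)
      show "(\<lambda>p. inv q \<circ> p) \<in> {p. p permutes U \<and> p ` A = C} \<rightarrow> {p. p permutes U \<and> p ` A = A}"
        using iq permutes_inv[OF q(1)] by (simp add: Pi_iff permutes_compose comp del: o_apply)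
    qed (use permutes_inverses[OF q(1)] in \<open>simp_all add: fun_eq_iff\<close>)
    then show ?thesis by (rule bij_betw_same_card[symmetric])
  qed
  have count: "card {p. p permutes U \<and> p ` A \<subseteq> B'} = (card B' choose card A) * ?N"
    if B': "B' \<subseteq> U" for B'
  proof -
    have fB: "finite B'" using U B' finite_subset by auto
    have "{p. p permutes U \<and> p ` A \<subseteq> B'}
        = (\<Union>C\<in>{C. C \<subseteq> B' \<and> card C = card A}. {p. p permutes U \<and> p ` A = C})"
      by (auto simp: card_image permutes_inj_on)
    also have "card \<dots> = (\<Sum>C\<in>{C. C \<subseteq> B' \<and> card C = card A}. card {p. p permutes U \<and> p ` A = C})"
      using fB U by (intro card_UN_disjoint) (auto intro: finite_subset[OF _ finite_permutations[OF U]])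
    also have "\<dots> = (\<Sum>C\<in>{C. C \<subseteq> B' \<and> card C = card A}. ?N)"
      using B' by (intro sum.cong refl eqN) auto
    also have "\<dots> = (card B' choose card A) * ?N"
      using fB by (simp add: n_subsets)
    finally show ?thesis .
  qed
  \<comment> \<open>The case \<open>B' = U\<close> covers all permutations and so determines
    \<open>?N\<close>.\<close>
  have "{p. p permutes U \<and> p ` A \<subseteq> U} = {p. p permutes U}"
    using A permutes_image by blast
  then have "fact (card U) = (card U choose card A) * ?N"
    using count[of U] card_permutations[OF refl U] by simp
  then show ?thesis using count[OF B] by simp
qed

text \<open>Every bad permutation is counted once for each of the at least \<open>k choose j\<close>
  sets of \<open>j\<close> inputs sent into \<open>B\<close>; taking \<open>j < k\<close> beats the plain union bound.\<close>

lemma card_permutes_confined: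
  fixes U :: "'a set" and i :: "'a \<Rightarrow> 'b"
  assumes U: "finite U" and X: "finite X" and B: "B \<subseteq> U"
    and fibre: "\<And>x. x \<in> X \<Longrightarrow> card {s \<in> U. i s = x} = c"
  shows "card {p. p permutes U \<and> (\<exists>S\<subseteq>X. card S = k \<and> p ` {s \<in> U. i s \<in> S} \<subseteq> B)}
           * ((k choose j) * (card U choose (c * j)))
         \<le> fact (card U) * ((card X choose j) * (card B choose (c * j)))"
    (is "card ?bad * _ \<le> _")
proof -
  let ?J = "{J. J \<subseteq> X \<and> card J = j}"
  let ?P = "{p. p permutes U}"
  let ?R = "\<lambda>p J. p ` {s \<in> U. i s \<in> J} \<subseteq> B"
  let ?C = "card U choose (c * j)"
  have finP: "finite ?P" using finite_permutations[OF U] .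
  have finJ: "finite ?J" using X by simp
  have pre: "card {s \<in> U. i s \<in> J} = c * j" if "J \<in> ?J" for J
  proof -
    have fJ: "finite J" using that X finite_subset by auto
    have "{s \<in> U. i s \<in> J} = (\<Union>x\<in>J. {s \<in> U. i s = x})" by auto
    also have "card \<dots> = (\<Sum>x\<in>J. card {s \<in> U. i s = x})"
      using fJ U by (intro card_UN_disjoint) auto
    also have "\<dots> = (\<Sum>x\<in>J. c)" using that fibre by (intro sum.cong) auto
    finally show ?thesis using that by simp
  qed
  have "card ?bad * (k choose j) = (\<Sum>p\<in>?bad. (k choose j))" by simp
  also have "\<dots> \<le> (\<Sum>p\<in>?bad. card {J \<in> ?J. ?R p J})"
  proof (rule sum_mono)
    fix p assume "p \<in> ?bad"
    then obtain S where S: "S \<subseteq> X" "card S = k" "?R p S" by blast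
    have fS: "finite S" using S X finite_subset by auto
    have "(k choose j) = card {J. J \<subseteq> S \<and> card J = j}" using fS S by (simp add: n_subsets)
    also have "\<dots> \<le> card {J \<in> ?J. ?R p J}"
    proof (rule card_mono)
      show "finite {J \<in> ?J. ?R p J}" by (rule finite_subset[OF _ finJ]) auto
      show "{J. J \<subseteq> S \<and> card J = j} \<subseteq> {J \<in> ?J. ?R p J}"
      proof
        fix J assume "J \<in> {J. J \<subseteq> S \<and> card J = j}"
        moreover from this have "p ` {s \<in> U. i s \<in> J} \<subseteq> p ` {s \<in> U. i s \<in> S}"
          by (intro image_mono) auto
        ultimately show "J \<in> {J \<in> ?J. ?R p J}" using S by (simp, metis subset_trans)
      qed
    qed
    finally show "(k choose j) \<le> card {J \<in> ?J. ?R p J}" .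
  qed
  also have "\<dots> \<le> (\<Sum>p\<in>?P. card {J \<in> ?J. ?R p J})"
    by (rule sum_mono2[OF finP]) auto
  also have "\<dots> = (\<Sum>J\<in>?J. card {p \<in> ?P. ?R p J})"
    by (rule sum_multicount_gen[OF finP finJ]) auto
  finally have "card ?bad * (k choose j) * ?C \<le> (\<Sum>J\<in>?J. card {p \<in> ?P. ?R p J}) * ?C"
    by (rule mult_right_mono) simp
  also have "\<dots> = (\<Sum>J\<in>?J. card {p. p permutes U \<and> ?R p J} * ?C)"
    by (simp add: sum_distrib_right)
  also have "\<dots> = (\<Sum>J\<in>?J. fact (card U) * (card B choose (c * j)))"
  proof (rule sum.cong[OF refl])
    fix J assume J: "J \<in> ?J"
    show "card {p. p permutes U \<and> ?R p J} * ?C = fact (card U) * (card B choose (c * j))"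
      using card_permutes_image_subset[OF U _ B, of "{s \<in> U. i s \<in> J}"] unfolding pre[OF J] by blast
  qed
  also have "\<dots> = fact (card U) * ((card X choose j) * (card B choose (c * j)))"
    using X by (simp add: n_subsets)
  finally show ?thesis by (simp add: mult.assoc)
qed

section \<open>Estimates for binomial coefficients\<close>

lemma binomial_Suc_mult_real: "real (n choose Suc k) * real (Suc k) = real (n choose k) * (real n - real k)"
proof (cases "k \<le> n")
  case True
  have "(n choose Suc k) * Suc k = (n choose k) * (n - k)"
    by (metis binomial_absorb_comp binomial_absorption mult.commute)
  then have "real ((n choose Suc k) * Suc k) = real ((n choose k) * (n - k))" by simp
  then show ?thesis using True by (simp only: of_nat_mult of_nat_diff)
qed (simp add: binomial_eq_0)

section \<open>Entropy bounds for a single binomial coefficient\<close>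

lemma power_binomial_nat: "k \<le> n \<Longrightarrow> n ^ n = (\<Sum>i\<le>n. (n choose i) * k ^ i * (n - k) ^ (n - i))" for n :: nat
  using binomial[of k "n - k" n] by simp

text \<open>A single term of the binomial expansion of \<open>(k + (n - k)) ^ n\<close>. This is the
  entropy bound in integer form; \<open>0 ^ 0 = 1\<close> covers \<open>k = 0\<close> and
  \<open>k = n\<close>.\<close>

lemma binomial_entropy_upper:
  assumes "k \<le> n"
  shows "(n choose k) * (k ^ k * (n - k) ^ (n - k)) \<le> n ^ n"
proof -
  have "(n choose k) * k ^ k * (n - k) ^ (n - k) \<le> (\<Sum>i\<le>n. (n choose i) * k ^ i * (n - k) ^ (n - i))"
    using assms by (intro member_le_sum) auto
  then show ?thesis using power_binomial_nat[OF assms] by (simp add: mult.assoc)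
qed

text \<open>In the same expansion the terms rise up to index \<open>k\<close> and fall afterwards,
  so the one at \<open>k\<close> is the largest of \<open>n + 1\<close> terms.\<close>

lemma binomial_entropy_lower:
  assumes "k \<le> n"
  shows "n ^ n \<le> (n + 1) * ((n choose k) * (k ^ k * (n - k) ^ (n - k)))"
proof -
  define l where "l = n - k"
  define t where "t i = (n choose i) * k ^ i * l ^ (n - i)" for i
  \<comment> \<open>The quotient \<open>(n - i) * k / (Suc i * l)\<close> of neighbouring terms,
    kept free of division.\<close>
  have step: "t (Suc i) * (Suc i * l) = t i * ((n - i) * k)" if "i < n" for i
  proof -
    have "n - i = Suc (n - Suc i)" using that by simp
    then have "l ^ (n - i) = l * l ^ (n - Suc i)" by simp
    moreover have "(n choose Suc i) * Suc i = (n choose i) * (n - i)"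
      by (metis binomial_absorb_comp binomial_absorption mult.commute)
    ultimately show ?thesis
      unfolding t_def by (metis (no_types, opaque_lifting) mult.assoc mult.commute power_Suc)
  qed
  have up: "t i \<le> t (Suc i)" if "i < k" for i
  proof (cases "l = 0")
    case True
    then have "t i = 0" using that assms by (simp add: t_def)
    then show ?thesis by simp
  next
    case False
    have "Suc i * l \<le> (n - i) * k"
      using mult_le_mono[of l "n - i" "Suc i" k] that by (simp add: l_def mult.commute)
    then have "t i * (Suc i * l) \<le> t (Suc i) * (Suc i * l)"
      using step[of i] that assms by simp
    then show ?thesis using False by (simp only: mult_le_cancel2) simp
  qed
  have down: "t (Suc i) \<le> t i" if "k \<le> i" "i < n" for i
  proof -
    have "(n - i) * k \<le> Suc i * l"
      using mult_le_mono[of "n - i" l k "Suc i"] that by (simp add: l_def mult.commute)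
    then have "t (Suc i) * (Suc i * l) \<le> t i * (Suc i * l)"
      using step[of i] that by simp
    moreover have "l > 0" using that by (simp add: l_def)
    ultimately show ?thesis by (simp only: mult_le_cancel2) simp
  qed
  have "t i \<le> t k" if "i \<le> n" for i
  proof (cases "i \<le> k")
    case True
    then show ?thesis
      by (induction i rule: inc_induct) (auto intro: order_trans up)
  next
    case False
    then have "k \<le> i" by simp
    then show ?thesis using that
      by (induction i rule: dec_induct) (auto intro: order_trans[OF down])
  qed
  then have "(\<Sum>i\<le>n. t i) \<le> (\<Sum>i\<le>n. t k)" by (intro sum_mono) auto
  then show ?thesis
    using power_binomial_nat[OF assms] by (simp add: t_def l_def mult.assoc)
qed

lemma binomial_real_upper:
  assumes "k \<le> n" "0 < n"
  shows "real (n choose k) * ((real k / real n) ^ k * (real (n - k) / real n) ^ (n - k)) \<le> 1"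
proof -
  have n: "real n ^ k * real n ^ (n - k) = real n ^ n"
    using assms by (simp flip: power_add)
  have "real ((n choose k) * (k ^ k * (n - k) ^ (n - k))) \<le> real (n ^ n)"
    using binomial_entropy_upper[OF assms(1)] of_nat_le_iff by blast
  then show ?thesis using assms n by (simp add: power_divide field_simps)
qed

lemma binomial_real_lower:
  assumes "k \<le> n" "0 < n"
  shows "1 \<le> (real n + 1) * (real (n choose k) * ((real k / real n) ^ k * (real (n - k) / real n) ^ (n - k)))"
proof -
  have n: "real n ^ k * real n ^ (n - k) = real n ^ n"
    using assms by (simp flip: power_add)
  have "real (n ^ n) \<le> real ((n + 1) * ((n choose k) * (k ^ k * (n - k) ^ (n - k))))"
    using binomial_entropy_lower[OF assms(1)] of_nat_le_iff by blast
  then have "real n ^ n \<le> (real n + 1) * (real (n choose k) * (real k ^ k * real (n - k) ^ (n - k)))"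
    by (simp only: of_nat_mult of_nat_add of_nat_power of_nat_1)
  then show ?thesis using assms n by (simp add: power_divide field_simps)
qed

section \<open>Log-convexity of a quotient of binomial coefficients\<close>

text \<open>In the quotient of consecutive values of \<open>ratio5\<close> the factor \<open>(n - j) / (j + 1)\<close> cancels;
  the remaining product \<open>growth5\<close> is increasing in \<open>j\<close>, which makes \<open>ratio5\<close> log-convex.\<close>

definition ratio5 :: "nat \<Rightarrow> nat \<Rightarrow> real" where
  "ratio5 n j = real (n choose j) / real (5 * n choose (5 * j))"

definition growth5 :: "nat \<Rightarrow> nat \<Rightarrow> real" where
  "growth5 n j = (\<Prod>i\<in>{1..4}. real (5 * j + i) / (5 * real n - real (5 * j + i)))"

lemma ratio5_Suc:
  assumes "j < n"
  shows "ratio5 n (Suc j) = growth5 n j * ratio5 n j"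
proof -
  define x where "x = real (5 * n choose (5 * j))"
  have x: "x > 0" using assms by (simp add: x_def)
  have S: "5 * Suc j = Suc (Suc (Suc (Suc (Suc (5 * j)))))" by simp
  define N where "N = real n"
  define J where "J = real j"
  have NJ: "J + 1 \<le> N" "0 \<le> J" using assms unfolding N_def J_def by simp_all
  have st: "real (n' choose Suc k) = real (n' choose k) * (real n' - real k) / real (Suc k)" for n' k
    using binomial_Suc_mult_real[of n' k] by (simp add: field_simps)
  have top: "real (n choose Suc j) = real (n choose j) * (N - J) / (J + 1)"
    using st[of n j] by (simp add: N_def J_def add.commute)
  have bot: "real (5 * n choose (5 * Suc j)) =
     x * (5 * N - 5 * J) / (5 * J + 1) * (5 * N - (5 * J + 1)) / (5 * J + 2) * (5 * N - (5 * J + 2)) / (5 * J + 3)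
       * (5 * N - (5 * J + 3)) / (5 * J + 4) * (5 * N - (5 * J + 4)) / (5 * J + 5)"
    unfolding S st x_def N_def J_def by (simp add: add.commute add.left_commute)
  have g: "growth5 n j = (5 * J + 1) / (5 * N - (5 * J + 1)) * ((5 * J + 2) / (5 * N - (5 * J + 2))
      * ((5 * J + 3) / (5 * N - (5 * J + 3)) * ((5 * J + 4) / (5 * N - (5 * J + 4)))))"
    proof -
    have "{1..4::nat} = {1, 2, 3, 4}" by auto
    then show ?thesis by (simp add: growth5_def N_def J_def)
  qed
  \<comment> \<open>The cancellation in free variables: \<open>D\<close> stands for
    \<open>N - J\<close> and \<open>E\<close> for \<open>J + 1\<close>.\<close>
  have gen: "y * D / E / (x * (5 * D) / a * b / c * e / f * h / k * l / (5 * E)) =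
      a / b * (c / e * (f / h * (k / l))) * (y / x)"
    if "D > 0" "E > 0" "x > 0" "a > 0" "b > 0" "c > 0" "e > 0" "f > 0" "h > 0" "k > 0" "l > 0"
    for y D E x a b c e f h k l :: real
    using that by (simp add: field_simps)
  have "ratio5 n (Suc j) = real (n choose j) * (N - J) / (J + 1) /
     (x * (5 * (N - J)) / (5 * J + 1) * (5 * N - (5 * J + 1)) / (5 * J + 2) * (5 * N - (5 * J + 2)) / (5 * J + 3)
       * (5 * N - (5 * J + 3)) / (5 * J + 4) * (5 * N - (5 * J + 4)) / (5 * (J + 1)))"
    unfolding ratio5_def top bot by (simp add: algebra_simps)
  also have "\<dots> = growth5 n j * (real (n choose j) / x)"
    unfolding g using NJ x by (intro gen) auto
  finally show ?thesis by (simp add: ratio5_def x_def)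
qed

lemma growth5_nonneg: "j < n \<Longrightarrow> 0 \<le> growth5 n j"
  unfolding growth5_def by (intro prod_nonneg) auto

lemma growth5_mono:
  assumes "i \<le> j" "j < n"
  shows "growth5 n i \<le> growth5 n j"
  unfolding growth5_def
proof (intro prod_mono conjI)
  fix l :: nat assume "l \<in> {1..4}"
  then have l: "l \<le> 4" by simp
  have "5 * j + l < 5 * n" using assms l by linarith
  then have 1: "real (5 * j + l) < 5 * real n" by (metis of_nat_less_iff of_nat_mult of_nat_numeral)
  have 2: "real (5 * i + l) \<le> real (5 * j + l)" using assms by simp
  show "0 \<le> real (5 * i + l) / (5 * real n - real (5 * i + l))" using 1 2 by simp
  show "real (5 * i + l) / (5 * real n - real (5 * i + l)) \<le> real (5 * j + l) / (5 * real n - real (5 * j + l))"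
    using 1 2 by (intro frac_le) auto
qed

text \<open>Let \<open>h\<close> be the entropy factor of \<open>n choose j\<close>, which is at
  most \<open>1 / h\<close>. Since \<open>5 * j / (5 * n) = j / n\<close>, the denominator has
  entropy factor \<open>h ^ 5\<close> and is at least \<open>1 / ((5 * n + 1) * h ^ 5)\<close>. The
  quotient leaves \<open>h ^ 4\<close>.\<close>

lemma ratio5_le:
  assumes "j \<le> n" "0 < n"
  shows "ratio5 n j \<le> (5 * real n + 1) * ((real j / real n) ^ j * (real (n - j) / real n) ^ (n - j)) ^ 4"
proof -
  define h where "h = (real j / real n) ^ j * (real (n - j) / real n) ^ (n - j)"
  define c where "c = real (n choose j)"
  define C where "C = real (5 * n choose (5 * j))"
  have h0: "h \<ge> 0" by (simp add: h_def)
  have up: "c * h \<le> 1" using binomial_real_upper[OF assms] by (simp add: c_def h_def)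
  have sub: "5 * n - 5 * j = 5 * (n - j)" by simp
  have "(real (5 * j) / real (5 * n)) ^ (5 * j) * (real (5 * n - 5 * j) / real (5 * n)) ^ (5 * n - 5 * j) = h ^ 5"
    unfolding sub h_def power_mult_distrib power_mult[symmetric] by (simp add: mult.commute)
  then have lo: "1 \<le> (5 * real n + 1) * (C * h ^ 5)"
    using binomial_real_lower[of "5 * j" "5 * n"] assms by (simp add: C_def)
  have C0: "C > 0" using assms by (simp add: C_def)
  have "c \<le> c * ((5 * real n + 1) * (C * h ^ 5))"
    using mult_left_mono[OF lo, of c] by (simp add: c_def)
  also have "\<dots> = (c * h) * ((5 * real n + 1) * (C * h ^ 4))"
    by (simp add: algebra_simps power_Suc numeral_eq_Suc)
  also have "\<dots> \<le> 1 * ((5 * real n + 1) * (C * h ^ 4))"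
    using up h0 C0 by (intro mult_right_mono) auto
  finally have "c / C \<le> (5 * real n + 1) * h ^ 4" using C0 by (simp add: field_simps)
  then show ?thesis by (simp add: ratio5_def c_def C_def h_def)
qed

text \<open>Convexity without logarithms: the quotients \<open>q\<close> increase, so for
  \<open>k < b\<close> the values \<open>g\<close> rise from \<open>k\<close> to \<open>b\<close> if
  \<open>q k >= 1\<close> and fall from \<open>a\<close> to \<open>k\<close> otherwise.\<close>

lemma le_max_ends_of_increasing_growth:
  fixes g q :: "nat \<Rightarrow> real"
  assumes "a \<le> k" "k \<le> b"
    and g0: "\<And>i. a \<le> i \<Longrightarrow> i \<le> b \<Longrightarrow> 0 \<le> g i"
    and step: "\<And>i. a \<le> i \<Longrightarrow> i < b \<Longrightarrow> g (Suc i) = q i * g i"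
    and mono: "\<And>i j. a \<le> i \<Longrightarrow> i \<le> j \<Longrightarrow> j < b \<Longrightarrow> q i \<le> q j"
  shows "g k \<le> max (g a) (g b)"
proof (cases "k < b \<and> 1 \<le> q k")
  case True
  have "g k \<le> g i" if "k \<le> i" "i \<le> b" for i
    using that
  proof (induction i rule: dec_induct)
    case (step i)
    have "1 \<le> q i" using True mono[of k i] assms(1) step by auto
    then have "g i \<le> g (Suc i)"
      using assms(3)[of i] assms(1) assms(4)[of i] step mult_right_mono[of 1 "q i" "g i"] by auto
    then show ?case using step by auto
  qed simp
  then show ?thesis using assms(2) by (simp add: le_max_iff_disj)
next
  case False
  have "g k \<le> g a" if "k < b" "q k \<le> 1"
  proof -
    have "g k \<le> g i" if "a \<le> i" "i \<le> k" for i
      using that(2) that(1)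
    proof (induction i rule: inc_induct)
      case (step i)
      have "q i \<le> 1" using \<open>q k \<le> 1\<close> mono[of i k] \<open>k < b\<close> step by auto
      then have "g (Suc i) \<le> g i"
        using assms(3)[of i] assms(4)[of i] step \<open>k < b\<close> mult_right_mono[of "q i" 1 "g i"] by auto
      then show ?case using step by auto
    qed simp
    then show ?thesis using assms(1) by simp
  qed
  then show ?thesis using False assms(2) by (cases "k = b") (auto simp: le_max_iff_disj)
qed

text \<open>\<open>k ^ k / fact k\<close> is one term of the exponential series at
  \<open>k\<close>.\<close>

lemma power_le_three_power_fact: "real k ^ k \<le> 3 ^ k * fact k"
proof -
  have "(\<Sum>n\<in>{k}. real k ^ n /\<^sub>R fact n) \<le> (\<Sum>n. real k ^ n /\<^sub>R fact n)"
    by (intro sum_le_suminf summable_exp_generic) auto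
  then have "real k ^ k / fact k \<le> exp (real k)"
    by (simp add: exp_def field_simps)
  also have "\<dots> = exp 1 ^ k" by (simp flip: exp_of_nat_mult)
  also have "\<dots> \<le> 3 ^ k" using exp_le by (intro power_mono) auto
  finally show ?thesis by (simp add: field_simps)
qed

lemma binomial_le_three_power:
  assumes "0 < k"
  shows "real (n choose k) \<le> (3 * real n / real k) ^ k"
proof -
  have "real ((n choose k) * fact k) \<le> real (n ^ k)"
    using binomial_fact_pow of_nat_le_iff by blast
  then have a: "real (n choose k) * fact k \<le> real n ^ k" by simp
  have "real (n choose k) * real k ^ k \<le> real (n choose k) * (3 ^ k * fact k)"
    by (intro mult_left_mono power_le_three_power_fact) auto
  also have "\<dots> \<le> 3 ^ k * real n ^ k" using a by (simp add: mult.left_commute)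
  finally show ?thesis using assms by (simp add: power_divide power_mult_distrib field_simps)
qed

text \<open>The quotient of the two coefficients is the product of \<open>(b - i) / (n - i)\<close>
  over \<open>i < a\<close>, and each factor is at most \<open>b / n\<close>.\<close>

lemma binomial_quotient_le_power:
  assumes "a \<le> b" "b \<le> n" "0 < n"
  shows "real (b choose a) \<le> real (n choose a) * (real b / real n) ^ a"
  using assms
proof (induction a)
  case (Suc a)
  have nb: "(real b - real a) \<le> (real n - real a) * (real b / real n)"
  proof -
    have "real a * real b \<le> real a * real n" using Suc.prems by (intro mult_left_mono) auto
    then show ?thesis using Suc.prems by (simp add: field_simps)
  qed
  have "real (b choose Suc a) * real (Suc a) = real (b choose a) * (real b - real a)"
    by (rule binomial_Suc_mult_real)
  also have "\<dots> \<le> (real (n choose a) * (real b / real n) ^ a) * ((real n - real a) * (real b / real n))"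
    using Suc nb by (intro mult_mono) auto
  also have "\<dots> = (real (n choose a) * (real n - real a)) * (real b / real n) ^ Suc a" by simp
  also have "\<dots> = (real (n choose Suc a) * (real b / real n) ^ Suc a) * real (Suc a)"
    by (simp only: binomial_Suc_mult_real[symmetric] ac_simps)
  finally show ?case by (simp only: mult_le_cancel_right)
qed simp

text \<open>The basis of the exponential tilting: one term of the expansion of
  \<open>(1 + u) ^ b\<close>, with \<open>u\<close> free to be tuned.\<close>

lemma binomial_mult_power_le:
  fixes u :: real
  assumes "0 \<le> u"
  shows "real (b choose a) * u ^ a \<le> (1 + u) ^ b"
proof (cases "a \<le> b")
  case True
  have "real (b choose a) * u ^ a * 1 ^ (b - a) \<le> (\<Sum>i\<le>b. real (b choose i) * u ^ i * 1 ^ (b - i))"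
    using True assms by (intro member_le_sum) auto
  also have "\<dots> = (u + 1) ^ b" by (simp add: binomial_ring)
  finally show ?thesis by (simp add: add.commute)
qed (use assms in \<open>simp add: binomial_eq_0\<close>)

lemma sum_Pow_prod:
  fixes w :: "'a \<Rightarrow> real"
  assumes "finite Y"
  shows "(\<Sum>T\<in>Pow Y. \<Prod>y\<in>T. w y) = (\<Prod>y\<in>Y. 1 + w y)"
  using prod_add[OF assms, of w "\<lambda>_. 1"] by (simp add: add.commute)

section \<open>The failure probability\<close>

text \<open>The number of slots owned by \<open>T\<close>; the first \<open>2 * m\<close> outputs
  are those with eight slots.\<close>

definition slots :: "nat \<Rightarrow> nat set \<Rightarrow> nat" where
  "slots m T = 7 * card T + card (T \<inter> {..<2 * m})"

text \<open>Union bound over the output sets \<open>T\<close> of size \<open>k\<close>, each with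
  its \<open>j\<close>-th moment bound. It estimates a probability.\<close>

definition fail_bound :: "nat \<Rightarrow> nat \<Rightarrow> nat \<Rightarrow> real" where
  "fail_bound m k j =
     (\<Sum>T | T \<subseteq> {..<4 * m} \<and> card T = k. real (slots m T choose (5 * j)))
       * real (6 * m choose j) / (real (k choose j) * real (30 * m choose (5 * j)))"

text \<open>Every \<open>T\<close> owns at most \<open>8 * k\<close> slots. The crude estimates then
  give a \<open>k\<close>-th power with base \<open>216 * (4 / 15) ^ 5 * (k / m) ^ 3\<close>, which
  is about \<open>0.291\<close> at \<open>k = m\<close>.\<close>

lemma fail_bound_small:
  assumes "1 \<le> k" "k \<le> m"
  shows "fail_bound m k k \<le> (3 / 10) ^ k"
proof -
  define Q where "Q = real (30 * m choose (5 * k))"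
  have Q: "Q > 0" using assms by (simp add: Q_def)
  have slots_le: "slots m T \<le> 8 * k" if "T \<subseteq> {..<4 * m}" "card T = k" for T
  proof -
    have "card (T \<inter> {..<2 * m}) \<le> card T"
      using that by (intro card_mono) (auto intro: finite_subset)
    then show ?thesis using that by (simp add: slots_def)
  qed
  have "(\<Sum>T | T \<subseteq> {..<4 * m} \<and> card T = k. real (slots m T choose (5 * k)))
      \<le> (\<Sum>T | T \<subseteq> {..<4 * m} \<and> card T = k. real (8 * k choose (5 * k)))"
    using slots_le by (intro sum_mono) (auto intro!: binomial_right_mono)
  also have "\<dots> = real (4 * m choose k) * real (8 * k choose (5 * k))"
    by (simp add: n_subsets)
  finally have sum_le: "(\<Sum>T | T \<subseteq> {..<4 * m} \<and> card T = k. real (slots m T choose (5 * k)))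
      \<le> real (4 * m choose k) * real (8 * k choose (5 * k))" .
  have "fail_bound m k k \<le>
      (real (4 * m choose k) * real (8 * k choose (5 * k))) * real (6 * m choose k) / Q"
    unfolding fail_bound_def Q_def using sum_le
    by (auto intro!: divide_right_mono mult_right_mono)
  also have "\<dots> \<le> ((3 * real (4 * m) / real k) ^ k * (Q * (real (8 * k) / real (30 * m)) ^ (5 * k)))
      * (3 * real (6 * m) / real k) ^ k / Q"
    unfolding Q_def using assms
    by (intro divide_right_mono mult_mono binomial_le_three_power binomial_quotient_le_power) auto
  also have "\<dots> = ((3 * real (4 * m) / real k) * (real (8 * k) / real (30 * m)) ^ 5 * (3 * real (6 * m) / real k)) ^ k"
  proof -
    have "(A ^ k * (Q * B ^ (5 * k))) * C ^ k / Q = (A * B ^ 5 * C) ^ k" for A B C :: real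
      using Q by (simp add: power_mult power_mult_distrib)
    then show ?thesis .
  qed
  also have "(3 * real (4 * m) / real k) * (real (8 * k) / real (30 * m)) ^ 5 * (3 * real (6 * m) / real k)
      = (216 * 1024 / 759375) * (real k / real m) ^ 3"
    using assms by (simp add: field_simps power_divide eval_nat_numeral)
  also have "(\<dots>) ^ k \<le> (3 / 10) ^ k"
  proof (intro power_mono)
    have "(real k / real m) ^ 3 \<le> 1" using assms by (intro power_le_one) auto
    then show "(216 * 1024 / 759375) * (real k / real m) ^ 3 \<le> 3 / 10" by linarith
  qed auto
  finally show ?thesis .
qed

section \<open>Exponential tilting for the range from \<open>m\<close> to
  \<open>3 * m\<close>\<close>

text \<open>The values \<open>7 / 4\<close> for both tilting parameters (one for the output slots, one for the
  set of outputs) are close to the saddle point at \<open>k = 3 * m\<close>.\<close>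

definition tilted_bound :: "nat \<Rightarrow> nat \<Rightarrow> nat \<Rightarrow> real" where
  "tilted_bound m d k = ratio5 (6 * m) (k - d) / real (k choose d)
     * (((1 + 7 / 4 * (11 / 4)) * (11 / 4)) ^ (2 * m)
     * ((11 / 4) ^ 7 / (7 / 4)) ^ k / (7 / 4) ^ (5 * (k - d)))"

text \<open>With \<open>u = 7 / 4\<close> each coefficient is at most
  \<open>(1 + u) ^ slots m T / u ^ a\<close>. The seven slots common to all outputs are taken out as
  \<open>(1 + u) ^ (7 * k)\<close>. The condition \<open>card T = k\<close> is traded for a weight
  \<open>u\<close> per output and a division by \<open>u ^ k\<close>; the sum over all
  \<open>T\<close> then factors, with \<open>1 + u * (1 + u)\<close> for an eight-slot output and
  \<open>1 + u\<close> for a seven-slot one.\<close>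

lemma sum_slots_choose_le:
  "(\<Sum>T | T \<subseteq> {..<4 * m} \<and> card T = k. real (slots m T choose a))
     \<le> ((1 + 7 / 4 * (11 / 4)) * (11 / 4)) ^ (2 * m) * ((11 / 4) ^ 7 / (7 / 4)) ^ k / (7 / 4) ^ a"
proof -
  define u :: real where "u = 7 / 4"
  define w where "w y = u * (if y < 2 * m then 11 / 4 else 1)" for y :: nat
  let ?F = "{T. T \<subseteq> {..<4 * m} \<and> card T = k}"
  have u: "u > 0" "1 + u = 11 / 4" by (simp_all add: u_def)
  have each: "real (slots m T choose a) \<le> ((11 / 4) ^ 7 / u) ^ k / u ^ a * (\<Prod>y\<in>T. w y)" if "T \<in> ?F" for T
  proof -
    have fin: "finite T" using that finite_subset by auto
    have T: "card T = k" using that by simp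
    have "(\<Prod>y\<in>T. w y) = u ^ card T * (\<Prod>y\<in>T. if y < 2 * m then 11 / 4 else 1)"
      by (simp add: w_def prod.distrib)
    also have "(\<Prod>y\<in>T. if y < 2 * m then 11 / 4 else (1::real)) = (\<Prod>y\<in>T \<inter> {..<2 * m}. 11 / 4)"
      using fin by (subst prod.inter_restrict) (auto intro: prod.cong)
    finally have w: "(\<Prod>y\<in>T. w y) = u ^ k * (11 / 4) ^ card (T \<inter> {..<2 * m})" using T by simp
    have "real (slots m T choose a) * u ^ a \<le> (11 / 4) ^ slots m T"
      using binomial_mult_power_le[of u "slots m T" a] u by simp
    also have "\<dots> = ((11 / 4) ^ 7) ^ k * (11 / 4) ^ card (T \<inter> {..<2 * m})"
      by (simp add: slots_def T power_add power_mult)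
    finally show ?thesis unfolding w using u(1) by (simp add: field_simps power_divide)
  qed
  have "(\<Sum>T\<in>?F. real (slots m T choose a)) \<le> (\<Sum>T\<in>?F. ((11 / 4) ^ 7 / u) ^ k / u ^ a * (\<Prod>y\<in>T. w y))"
    by (rule sum_mono) (rule each)
  also have "\<dots> \<le> (\<Sum>T\<in>Pow {..<4 * m}. ((11 / 4) ^ 7 / u) ^ k / u ^ a * (\<Prod>y\<in>T. w y))"
  proof (intro sum_mono2)
    have "0 \<le> w y" for y using u by (simp add: w_def)
    then show "0 \<le> ((11 / 4) ^ 7 / u) ^ k / u ^ a * (\<Prod>y\<in>T. w y)" for T
      using u by (intro mult_nonneg_nonneg prod_nonneg) auto
  qed auto
  also have "\<dots> = ((11 / 4) ^ 7 / u) ^ k / u ^ a * (\<Prod>y<4 * m. 1 + w y)"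
    by (simp only: sum_distrib_left[symmetric] sum_Pow_prod[OF finite_lessThan])
  also have "(\<Prod>y<4 * m. 1 + w y) = ((1 + 7 / 4 * (11 / 4)) * (11 / 4)) ^ (2 * m)"
  proof -
    have "{..<4 * m} = {..<2 * m} \<union> {2 * m..<4 * m}" by auto
    then have "(\<Prod>y<4 * m. 1 + w y) = (\<Prod>y<2 * m. 1 + w y) * (\<Prod>y=2 * m..<4 * m. 1 + w y)"
      by (simp add: prod.union_disjoint ivl_disj_int)
    also have "(\<Prod>y<2 * m. 1 + w y) = (1 + 7 / 4 * (11 / 4)) ^ (2 * m)"
      by (simp add: w_def u_def)
    also have "(\<Prod>y=2 * m..<4 * m. 1 + w y) = (11 / 4) ^ (2 * m)"
      by (simp add: w_def u_def)
    finally show ?thesis by (simp only: power_mult_distrib)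
  qed
  finally show ?thesis by (simp add: u_def mult_ac)
qed

lemma fail_bound_le_tilted_bound:
  assumes "d \<le> k"
  shows "fail_bound m k (k - d) \<le> tilted_bound m d k"
proof -
  have sym: "k choose (k - d) = k choose d" using binomial_symmetric[OF assms] by simp
  define r where "r = ratio5 (6 * m) (k - d) / real (k choose d)"
  define S where "S = (\<Sum>T | T \<subseteq> {..<4 * m} \<and> card T = k. real (slots m T choose (5 * (k - d))))"
  define R where "R = ((1 + 7 / 4 * (11 / 4)) * (11 / 4)) ^ (2 * m) * ((11 / 4) ^ 7 / (7 / 4)) ^ k / (7 / 4 :: real) ^ (5 * (k - d))"
  have "fail_bound m k (k - d) = r * S"
    unfolding fail_bound_def S_def[symmetric] r_def ratio5_def sym by (simp add: ac_simps)
  also have "\<dots> \<le> r * R"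
    unfolding S_def R_def by (intro mult_left_mono sum_slots_choose_le) (simp add: r_def ratio5_def)
  also have "\<dots> = tilted_bound m d k" by (simp only: tilted_bound_def r_def R_def)
  finally show ?thesis .
qed

text \<open>The quotient of consecutive values is a \<open>growth5\<close> value times
  \<open>(k + 1 - d) / (k + 1)\<close> times a constant, which is nondecreasing in
  \<open>k\<close>.\<close>

lemma tilted_bound_le_max_ends:
  assumes d: "d \<le> m" and k: "m \<le> k" "k \<le> 3 * m"
  shows "tilted_bound m d k \<le> max (tilted_bound m d m) (tilted_bound m d (3 * m))"
proof -
  \<comment> \<open>What the geometric factors gain when \<open>k\<close> grows by one.\<close>
  define c :: real where "c = ((11 / 4) ^ 7 / (7 / 4)) / (7 / 4) ^ 5"
  define q where "q i = growth5 (6 * m) (i - d) * (real (Suc i - d) / real (Suc i)) * c" for i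
  have c: "c > 0" by (simp add: c_def)
  show ?thesis
  proof (rule le_max_ends_of_increasing_growth[where q = q, OF k])
    fix i assume i: "m \<le> i" "i \<le> 3 * m"
    show "0 \<le> tilted_bound m d i" by (simp add: tilted_bound_def ratio5_def)
  next
    fix i assume i: "m \<le> i" "i < 3 * m"
    have sd: "Suc i - d = Suc (i - d)" using i d by simp
    have r: "ratio5 (6 * m) (Suc i - d) = growth5 (6 * m) (i - d) * ratio5 (6 * m) (i - d)"
      unfolding sd using i by (intro ratio5_Suc) simp
    have "(Suc i choose d) * (Suc i - d) = (i choose d) * Suc i"
      using binomial_absorb_comp[of "Suc i" d] by (simp add: mult.commute)
    then have b: "real (Suc i choose d) * real (Suc i - d) = real (i choose d) * real (Suc i)"
      by (simp only: of_nat_mult[symmetric])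
    have pos: "real (Suc i - d) > 0" "real (Suc i choose d) > 0" "real (i choose d) > 0"
      using i d by auto
    have inv: "1 / real (Suc i choose d) = real (Suc i - d) / real (Suc i) * (1 / real (i choose d))"
    proof -
      have "1 / A = B / C * (1 / D)" if "A > 0" "C > 0" "D > 0" "A * B = D * C" for A B C D :: real
        using that by (simp add: field_simps)
      then show ?thesis using pos b by simp
    qed
    have e: "5 * (Suc i - d) = 5 * (i - d) + 5" using sd by simp
    define A :: real where "A = ((1 + 7 / 4 * (11 / 4)) * (11 / 4)) ^ (2 * m)"
    define al :: real where "al = (11 / 4) ^ 7 / (7 / 4)"
    define u :: real where "u = 7 / 4"
    have "tilted_bound m d (Suc i) = ratio5 (6 * m) (Suc i - d) * (1 / real (Suc i choose d))
        * (A * al ^ Suc i / u ^ (5 * (Suc i - d)))"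
      by (simp add: tilted_bound_def A_def al_def u_def)
    also have "\<dots> = growth5 (6 * m) (i - d) * (real (Suc i - d) / real (Suc i)) * (al / u ^ 5)
        * (ratio5 (6 * m) (i - d) * (1 / real (i choose d)) * (A * al ^ i / u ^ (5 * (i - d))))"
      unfolding r inv e by (simp add: power_add ac_simps)
    also have "\<dots> = q i * tilted_bound m d i"
      by (simp add: q_def c_def tilted_bound_def A_def al_def u_def)
    finally show "tilted_bound m d (Suc i) = q i * tilted_bound m d i" .
  next
    fix i j assume ij: "m \<le> i" "i \<le> j" "j < 3 * m"
    have "real (Suc i - d) / real (Suc i) \<le> real (Suc j - d) / real (Suc j)"
    proof -
      have "real d * real (Suc i) \<le> real d * real (Suc j)" using ij by (intro mult_left_mono) auto
      then show ?thesis using ij d by (simp add: of_nat_diff field_simps)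
    qed
    moreover have "growth5 (6 * m) (i - d) \<le> growth5 (6 * m) (j - d)"
      using ij by (intro growth5_mono) auto
    moreover have "0 \<le> growth5 (6 * m) (j - d)" using ij by (intro growth5_nonneg) auto
    ultimately show "q i \<le> q j"
      unfolding q_def using c by (intro mult_right_mono mult_mono) auto
  qed
qed

text \<open>Replaces the entropy factors by powers of fixed numbers bounding the relative
  frequencies, so that only numerals remain to be compared. The two linear factors are the losses
  \<open>n + 1\<close> of the lower entropy bound, for \<open>n = 30 * m\<close> and for
  \<open>n = k\<close>.\<close>

lemma tilted_bound_le:
  fixes a b c e :: real
  assumes k: "d \<le> k" "0 < k" "k \<le> 3 * m" and nonneg: "0 \<le> a" "0 \<le> b" "0 \<le> c" "0 \<le> e"
    and a: "real (k - d) \<le> a * real (6 * m)" and b: "real (6 * m - (k - d)) \<le> b * real (6 * m)"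
    and c: "real d \<le> c * real k" and e: "real (k - d) \<le> e * real k"
  shows "tilted_bound m d k \<le> (30 * real m + 1) * (3 * real m + 1) *
     ((a ^ (k - d) * b ^ (6 * m - (k - d))) ^ 4 * (c ^ d * e ^ (k - d))
     * (((1 + 7 / 4 * (11 / 4)) * (11 / 4)) ^ (2 * m) * ((11 / 4) ^ 7 / (7 / 4)) ^ k / (7 / 4) ^ (5 * (k - d))))"
proof -
  define j where "j = k - d"
  define R :: real where "R = ((1 + 7 / 4 * (11 / 4)) * (11 / 4)) ^ (2 * m) * ((11 / 4) ^ 7 / (7 / 4)) ^ k / (7 / 4) ^ (5 * j)"
  have m: "m > 0" using k by simp
  have jm: "j \<le> 6 * m" using k by (simp add: j_def)
  have "ratio5 (6 * m) j \<le> (5 * real (6 * m) + 1)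
      * ((real j / real (6 * m)) ^ j * (real (6 * m - j) / real (6 * m)) ^ (6 * m - j)) ^ 4"
    using m jm by (intro ratio5_le) auto
  also have "\<dots> \<le> (5 * real (6 * m) + 1) * (a ^ j * b ^ (6 * m - j)) ^ 4"
    using a b m nonneg by (intro mult_left_mono power_mono mult_mono)
      (auto simp: j_def divide_le_eq intro!: zero_le_power)
  finally have 1: "ratio5 (6 * m) j \<le> (30 * real m + 1) * (a ^ j * b ^ (6 * m - j)) ^ 4" by simp
  have "1 \<le> (real k + 1) * (real (k choose d) * ((real d / real k) ^ d * (real j / real k) ^ j))"
    using binomial_real_lower[of d k] k by (simp add: j_def)
  also have "\<dots> \<le> (3 * real m + 1) * (real (k choose d) * (c ^ d * e ^ j))"
    using c e k nonneg by (intro mult_mono mult_left_mono power_mono)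
      (auto simp: j_def divide_le_eq)
  finally have 2: "1 / real (k choose d) \<le> (3 * real m + 1) * (c ^ d * e ^ j)"
    using k by (simp add: field_simps)
  have "tilted_bound m d k = ratio5 (6 * m) j * (1 / real (k choose d)) * R"
    by (simp add: tilted_bound_def j_def R_def)
  also have "\<dots> \<le> ((30 * real m + 1) * (a ^ j * b ^ (6 * m - j)) ^ 4) * ((3 * real m + 1) * (c ^ d * e ^ j)) * R"
    using 1 2 nonneg by (intro mult_mono mult_right_mono) (auto simp: R_def ratio5_def)
  finally show ?thesis by (simp only: j_def R_def mult_ac)
qed

text \<open>Used with \<open>m = 8 * q + s\<close>: each of the \<open>q\<close> full blocks
  contributes \<open>X\<close>, and each unit of the remainder \<open>s\<close> contributes
  \<open>Y\<close>.\<close>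

lemma mult_powers_le:
  fixes P X Y x :: real
  assumes "0 \<le> P" "0 \<le> X" "X \<le> x" "0 \<le> Y" "Y \<le> 1"
  shows "P * (X ^ q * Y ^ s) \<le> P * x ^ q"
proof -
  have "X ^ q * Y ^ s \<le> x ^ q * 1"
    using assms by (intro mult_mono power_mono power_le_one) auto
  then show ?thesis using assms(1) by (simp add: mult_left_mono)
qed

section \<open>The end points\<close>

text \<open>One block of the bound at \<open>k = m\<close>. The exponents are those of
  \<open>m = 8\<close>, \<open>d = 1\<close>, so \<open>k - d = 7\<close> and
  \<open>6 * m - (k - d) = 41\<close>. The numbers \<open>15 / 100\<close>, \<open>43 / 50\<close>,
  \<open>9 / 10\<close> slightly exceed \<open>7 / 48\<close>, \<open>41 / 48\<close>,
  \<open>7 / 8\<close> to leave room for the remainder of \<open>m\<close> modulo 8.\<close>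

lemma bottom_base_le:
  "((15 / 100) ^ 7 * (43 / 50) ^ 41) ^ 4 * (1 / 8 * (9 / 10) ^ 7)
     * (((1 + 7 / 4 * (11 / 4)) * (11 / 4)) ^ 16 * ((11 / 4) ^ 7 / (7 / 4)) ^ 8 / (7 / 4) ^ 35) \<le> (729 / 1000 :: real)"
proof -
  \<comment> \<open>Collects almost everything in one seventh power, whose base can be rounded to
    \<open>1 / 60\<close> first.\<close>
  have regroup: "(a ^ 7 * b ^ 41) ^ 4 * (c * e ^ 7) * ((B * A) ^ 16 * (A ^ 7 / u) ^ 8 / u ^ 35)
      = (a ^ 4 * e * A ^ 10 / u ^ 6 * b ^ 23) ^ 7 * (b ^ 3 * c * A ^ 2 / u) * B ^ 16"
    if "u \<noteq> 0" for a b c e A B u :: real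
    using that power_Suc2[of u 42] power_add[of b 161 3] power_add[of A 70 2]
    by (simp add: power_mult_distrib power_divide ac_simps)
  have mono: "t ^ 7 * r * B ^ 16 \<le> t' ^ 7 * r * B' ^ 16"
    if "0 \<le> t" "t \<le> t'" "0 \<le> B" "B \<le> B'" "0 \<le> r" for t t' r B B' :: real
    using that by (intro mult_mono power_mono) auto
  have "(43 / 50 :: real) ^ 23 \<le> 1 / 30" by (simp add: power_divide)
  then have "(15 / 100) ^ 4 * (9 / 10) * (11 / 4) ^ 10 / (7 / 4) ^ 6 * (43 / 50) ^ 23
      \<le> (15 / 100) ^ 4 * (9 / 10) * (11 / 4) ^ 10 / (7 / 4) ^ 6 * (1 / 30 :: real)"
    by (rule mult_left_mono) simp
  also have "\<dots> \<le> 1 / 60" by (simp add: power_divide)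
  finally have t: "(15 / 100) ^ 4 * (9 / 10) * (11 / 4) ^ 10 / (7 / 4) ^ 6 * (43 / 50) ^ 23 \<le> (1 / 60 :: real)" .
  have "((15 / 100) ^ 4 * (9 / 10) * (11 / 4) ^ 10 / (7 / 4) ^ 6 * (43 / 50) ^ 23) ^ 7
        * ((43 / 50) ^ 3 * (1 / 8) * (11 / 4) ^ 2 / (7 / 4)) * (1 + 7 / 4 * (11 / 4)) ^ 16
      \<le> (1 / 60) ^ 7 * ((43 / 50) ^ 3 * (1 / 8) * (11 / 4) ^ 2 / (7 / 4)) * (6 :: real) ^ 16"
    by (rule mono[OF _ t]) simp_all
  also have "\<dots> \<le> 729 / 1000" by (simp add: power_divide)
  finally show ?thesis by (subst regroup) simp_all
qed

text \<open>One block at \<open>k = 3 * m\<close>, again for \<open>m = 8\<close>,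
  \<open>d = 1\<close>: now \<open>k - d = 23\<close> and \<open>6 * m - (k - d) = 25\<close>. Here
  \<open>48 / 100\<close> and \<open>959 / 1000\<close> stand for \<open>23 / 48\<close> and
  \<open>23 / 24\<close>.\<close>

lemma top_base_le:
  "((48 / 100) ^ 23 * (25 / 48) ^ 25) ^ 4 * (1 / 24 * (959 / 1000) ^ 23)
     * (((1 + 7 / 4 * (11 / 4)) * (11 / 4)) ^ 16 * ((11 / 4) ^ 7 / (7 / 4)) ^ 24 / (7 / 4) ^ 115) \<le> (729 / 1000 :: real)"
proof -
  \<comment> \<open>Grouped into a 23rd and an 8th power, the product survives rounding to four digits.\<close>
  have regroup: "(a ^ 23 * b ^ 25) ^ 4 * (c * e ^ 23) * ((B * A) ^ 16 * (A ^ 7 / u) ^ 24 / u ^ 115)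
      = ((a * b) ^ 4 * e * A ^ 8 / u ^ 6) ^ 23 * (c / u) * (B ^ 2 * b) ^ 8"
    if "u \<noteq> 0" for a b c e A B u :: real
    using that power_Suc2[of u 138] by (simp add: power_mult_distrib power_divide ac_simps)
  have mono: "t ^ 23 * r * B ^ 8 \<le> t' ^ 23 * r * B' ^ 8"
    if "0 \<le> t" "t \<le> t'" "0 \<le> B" "B \<le> B'" "0 \<le> r" for t t' r B B' :: real
    using that by (intro mult_mono power_mono) auto
  have t: "(48 / 100 * (25 / 48)) ^ 4 * (959 / 1000) * (11 / 4) ^ 8 / (7 / 4) ^ 6 \<le> (4267 / 10000 :: real)"
    and v: "(1 + 7 / 4 * (11 / 4)) ^ 2 * (25 / 48) \<le> (176 / 10 :: real)"
    by (simp_all add: power_divide)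
  have "((48 / 100 * (25 / 48)) ^ 4 * (959 / 1000) * (11 / 4) ^ 8 / (7 / 4) ^ 6) ^ 23
        * (1 / 24 / (7 / 4)) * ((1 + 7 / 4 * (11 / 4)) ^ 2 * (25 / 48)) ^ 8
      \<le> (4267 / 10000) ^ 23 * (1 / 24 / (7 / 4)) * (176 / 10 :: real) ^ 8"
    by (rule mono[OF _ t _ v]) simp_all
  also have "\<dots> \<le> 729 / 1000" by (simp add: power_divide)
  finally show ?thesis by (subst regroup) simp_all
qed

lemma tilted_bound_bottom_le:
  assumes "s < 8" "100 \<le> q"
  shows "tilted_bound (8 * q + s) q (8 * q + s)
     \<le> (30 * real (8 * q + s) + 1) * (3 * real (8 * q + s) + 1) * (729 / 1000) ^ q"
proof -
  define m where "m = 8 * q + s"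
  have j: "m - q = 7 * q + s" "6 * m - (7 * q + s) = 41 * q + 5 * s"
    by (simp_all add: m_def)
  \<comment> \<open>Separates the \<open>q\<close> full blocks of eight from the remainder
    \<open>s\<close>.\<close>
  have split: "(a ^ (7 * q + s) * b ^ (41 * q + 5 * s)) ^ 4 * (c ^ q * e ^ (7 * q + s))
      * (K ^ (2 * (8 * q + s)) * al ^ (8 * q + s) / u ^ (5 * (7 * q + s)))
      = ((a ^ 7 * b ^ 41) ^ 4 * (c * e ^ 7) * (K ^ 16 * al ^ 8 / u ^ 35)) ^ q
      * ((a * b ^ 5) ^ 4 * e * (K ^ 2 * al / u ^ 5)) ^ s" for a b c e K al u :: real
    by (simp add: power_mult_distrib power_divide power_mult[symmetric] power_add algebra_simps)
  have "tilted_bound m q m \<le> (30 * real m + 1) * (3 * real m + 1) *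
     (((15 / 100) ^ (m - q) * (43 / 50) ^ (6 * m - (m - q))) ^ 4 * ((1 / 8) ^ q * (9 / 10) ^ (m - q))
     * (((1 + 7 / 4 * (11 / 4)) * (11 / 4)) ^ (2 * m) * ((11 / 4) ^ 7 / (7 / 4)) ^ m / (7 / 4) ^ (5 * (m - q))))"
  proof -
    have r: "real (m - q) = 7 * real q + real s" "real (6 * m - (m - q)) = 41 * real q + 5 * real s"
      "real (6 * m) = 48 * real q + 6 * real s" "real (m) = 8 * real q + real s"
      unfolding j by (simp_all add: m_def)
    have "real s \<le> 7" "100 \<le> real q" using assms by simp_all
    then show ?thesis
      by (intro tilted_bound_le; (unfold r)?) (use assms m_def in \<open>simp_all\<close>)
  qed
  also have "\<dots> \<le> (30 * real m + 1) * (3 * real m + 1) * (729 / 1000) ^ q"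
    unfolding j unfolding m_def split
    by (rule mult_powers_le[OF _ _ bottom_base_le]) (simp_all add: power_divide)
  finally show ?thesis by (simp add: m_def)
qed

lemma tilted_bound_top_le:
  assumes "s < 8" "100 \<le> q"
  shows "tilted_bound (8 * q + s) q (3 * (8 * q + s))
     \<le> (30 * real (8 * q + s) + 1) * (3 * real (8 * q + s) + 1) * (729 / 1000) ^ q"
proof -
  define m where "m = 8 * q + s"
  have j: "3 * m - q = 23 * q + 3 * s" "6 * m - (23 * q + 3 * s) = 25 * q + 3 * s"
    by (simp_all add: m_def)
  have split: "(a ^ (23 * q + 3 * s) * b ^ (25 * q + 3 * s)) ^ 4 * (c ^ q * e ^ (23 * q + 3 * s))
      * (K ^ (2 * (8 * q + s)) * al ^ (3 * (8 * q + s)) / u ^ (5 * (23 * q + 3 * s)))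
      = ((a ^ 23 * b ^ 25) ^ 4 * (c * e ^ 23) * (K ^ 16 * al ^ 24 / u ^ 115)) ^ q
      * ((a ^ 3 * b ^ 3) ^ 4 * e ^ 3 * (K ^ 2 * al ^ 3 / u ^ 15)) ^ s" for a b c e K al u :: real
    by (simp add: power_mult_distrib power_divide power_mult[symmetric] power_add algebra_simps)
  have "tilted_bound m q (3 * m) \<le> (30 * real m + 1) * (3 * real m + 1) *
     (((48 / 100) ^ (3 * m - q) * (25 / 48) ^ (6 * m - (3 * m - q))) ^ 4 * ((1 / 24) ^ q * (959 / 1000) ^ (3 * m - q))
     * (((1 + 7 / 4 * (11 / 4)) * (11 / 4)) ^ (2 * m) * ((11 / 4) ^ 7 / (7 / 4)) ^ (3 * m) / (7 / 4) ^ (5 * (3 * m - q))))"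
  proof -
    have r: "real (3 * m - q) = 23 * real q + 3 * real s" "real (6 * m - (3 * m - q)) = 25 * real q + 3 * real s"
      "real (6 * m) = 48 * real q + 6 * real s" "real (3 * m) = 3 * (8 * real q + real s)"
      unfolding j by (simp_all add: m_def)
    \<comment> \<open>The tightest frequency bound is
      \<open>23 * q + 3 * s <= 959 / 1000 * (24 * q + 3 * s)\<close>; it needs \<open>q\<close>
      large compared with \<open>s\<close>.\<close>
    have "real s \<le> 7" "100 \<le> real q" using assms by simp_all
    then show ?thesis
      by (intro tilted_bound_le; (unfold r)?) (use assms m_def in \<open>simp_all\<close>)
  qed
  also have "\<dots> \<le> (30 * real m + 1) * (3 * real m + 1) * (729 / 1000) ^ q"
    unfolding j unfolding m_def split
    by (rule mult_powers_le[OF _ _ top_base_le]) (simp_all add: power_divide)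
  finally show ?thesis by (simp add: m_def)
qed

text \<open>\<open>729 / 1000\<close> is the cube of \<open>9 / 10\<close>, so this is a multiple of
  the cube of the null sequence \<open>q * (9 / 10) ^ q\<close>. The constant is
  \<open>2 * 15 * 451 * 46\<close>, from the sum over \<open>k > m\<close>.\<close>

lemma eventually_cubic_times_power_small:
  "\<exists>q0. \<forall>q\<ge>q0. 622380 * real q ^ 3 * (729 / 1000) ^ q < 1 / 2"
proof -
  have "(\<lambda>q. real q * (9 / 10) ^ q) \<longlonglongrightarrow> 0"
    using powser_times_n_limit_0[of "9 / 10 :: real"] by simp
  then have "(\<lambda>q. 622380 * (real q * (9 / 10) ^ q) ^ 3) \<longlonglongrightarrow> 622380 * 0 ^ 3"
    by (intro tendsto_intros)
  then have "\<forall>\<^sub>F q in sequentially. 622380 * (real q * (9 / 10) ^ q) ^ 3 < 1 / 2"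
    by (rule order_tendstoD) simp
  moreover have "(real q * (9 / 10) ^ q) ^ 3 = real q ^ 3 * (729 / 1000) ^ q" for q
  proof -
    have "((9 / 10 :: real) ^ q) ^ 3 = ((9 / 10) ^ 3) ^ q"
      by (simp only: power_mult[symmetric] mult.commute)
    also have "(9 / 10 :: real) ^ 3 = 729 / 1000" by (simp add: power_divide)
    finally show ?thesis by (simp only: power_mult_distrib)
  qed
  ultimately show ?thesis by (simp add: eventually_sequentially mult.assoc)
qed

lemma sum_fail_bound_less_1:
  "\<exists>m0. \<forall>m\<ge>m0. \<exists>j. (\<forall>k. j k \<le> k) \<and> (\<Sum>k=1..3 * m. fail_bound m k (j k)) < 1"
proof -
  obtain q0 where q0: "\<And>q. q0 \<le> q \<Longrightarrow> 622380 * real q ^ 3 * (729 / 1000) ^ q < 1 / 2"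
    using eventually_cubic_times_power_small by blast
  show ?thesis
  proof (intro exI[of _ "8 * (q0 + 100)"] allI impI)
    fix m assume m: "8 * (q0 + 100) \<le> m"
    define q where "q = m div 8"
    define s where "s = m mod 8"
    have ms: "m = 8 * q + s" "s < 8" by (simp_all add: q_def s_def)
    have q: "q0 \<le> q" "100 \<le> q" proof -
      have "q0 + 100 \<le> q" using m by (simp add: q_def less_eq_div_iff_mult_less_eq)
      then show "q0 \<le> q" "100 \<le> q" by simp_all
    qed
    define B :: real where "B = (30 * real m + 1) * (3 * real m + 1) * (729 / 1000) ^ q"
    have ends: "tilted_bound m q m \<le> B" "tilted_bound m q (3 * m) \<le> B"
      using tilted_bound_bottom_le[OF ms(2) q(2)] tilted_bound_top_le[OF ms(2) q(2)]
      unfolding B_def ms(1)[symmetric] by auto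
    define j where "j k = (if k \<le> m then k else k - q)" for k
    \<comment> \<open>A geometric series; \<open>3 / 7\<close> leaves room for the
      \<open>1 / 2\<close> of the other range.\<close>
    have small: "(\<Sum>k=1..m. fail_bound m k (j k)) \<le> 3 / 7"
    proof -
      have "(\<Sum>k=1..m. fail_bound m k (j k)) \<le> (\<Sum>k=1..m. (3 / 10) ^ k)"
        by (intro sum_mono) (auto simp: j_def intro!: fail_bound_small)
      also have "\<dots> \<le> 3 / 7" by (simp add: sum_gp)
      finally show ?thesis .
    qed
    have "(\<Sum>k=m + 1..3 * m. fail_bound m k (j k)) \<le> (\<Sum>k=m + 1..3 * m. B)"
    proof (rule sum_mono)
      fix k assume k: "k \<in> {m + 1..3 * m}"
      have "fail_bound m k (j k) \<le> tilted_bound m q k"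
        using k ms by (auto simp: j_def intro!: fail_bound_le_tilted_bound)
      also have "\<dots> \<le> max (tilted_bound m q m) (tilted_bound m q (3 * m))"
        using k ms by (intro tilted_bound_le_max_ends) auto
      also have "\<dots> \<le> B" using ends by simp
      finally show "fail_bound m k (j k) \<le> B" .
    qed
    also have "\<dots> = 2 * real m * B" by simp
    \<comment> \<open>As \<open>s <= 7 <= 7 * q\<close>, \<open>m\<close> is at most
      \<open>15 * q\<close>, so the linear factors are at most \<open>451 * q\<close> and
      \<open>46 * q\<close>.\<close>
    also have "\<dots> \<le> 2 * (15 * real q) * ((451 * real q) * (46 * real q) * (729 / 1000) ^ q)"
      unfolding B_def using ms q by (intro mult_mono) auto
    also have "\<dots> = 622380 * real q ^ 3 * (729 / 1000) ^ q" by (simp add: eval_nat_numeral)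
    also have "\<dots> < 1 / 2" using q0[OF q(1)] .
    finally have large: "(\<Sum>k=m + 1..3 * m. fail_bound m k (j k)) < 1 / 2" .
    have "{1..3 * m} = {1..m} \<union> {m + 1..3 * m}" by auto
    then have "(\<Sum>k=1..3 * m. fail_bound m k (j k))
        = (\<Sum>k=1..m. fail_bound m k (j k)) + (\<Sum>k=m + 1..3 * m. fail_bound m k (j k))"
      by (simp only:) (rule sum.union_disjoint; auto)
    then have "(\<Sum>k=1..3 * m. fail_bound m k (j k)) < 1" using small large by linarith
    moreover have "\<forall>k. j k \<le> k" by (simp add: j_def)
    ultimately show "\<exists>j. (\<forall>k. j k \<le> k) \<and> (\<Sum>k=1..3 * m. fail_bound m k (j k)) < 1" by blast
  qed
qed

section \<open>The random graph\<close>

text \<open>The \<open>16 * m\<close> slots of the eight-slot outputs come first, followed by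
  \<open>14 * m\<close> slots in blocks of seven. On the input side the owner of slot
  \<open>s\<close> is simply \<open>s div 5\<close>.\<close>

definition owner :: "nat \<Rightarrow> nat \<Rightarrow> nat" where
  "owner m s = (if s < 16 * m then s div 8 else 2 * m + (s - 16 * m) div 7)"

lemma owner_less:
  assumes "s < 30 * m"
  shows "owner m s < 4 * m"
proof (cases "s < 16 * m")
  case True
  then have "s div 8 < 2 * m" by (simp add: div_less_iff_less_mult)
  then show ?thesis using True by (simp add: owner_def)
next
  case False
  have "(s - 16 * m) div 7 < 2 * m"
    using assms False by (simp add: div_less_iff_less_mult)
  then show ?thesis using False by (simp add: owner_def)
qed

lemma card_owner_fibre:
  assumes "y < 4 * m"
  shows "card {s \<in> {..<30 * m}. owner m s = y} = (if y < 2 * m then 8 else 7)"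
proof (cases "y < 2 * m")
  case True
  have "{s \<in> {..<30 * m}. owner m s = y} = {8 * y..<8 * y + 8}"
  proof -
    have "owner m x = y \<longleftrightarrow> 8 * y \<le> x \<and> x < 8 * y + 8" for x
    proof (cases "x < 16 * m")
      case x: True
      have "x div 8 = y \<longleftrightarrow> 8 * y \<le> x \<and> x < 8 * y + 8" by linarith
      then show ?thesis using x by (simp add: owner_def)
    next
      case x: False
      then show ?thesis using True by (simp add: owner_def)
    qed
    then have "{s \<in> {..<30 * m}. owner m s = y} = {..<30 * m} \<inter> {8 * y..<8 * y + 8}"
      by (simp add: set_eq_iff)
    also have "\<dots> = {8 * y..<8 * y + 8}" using True by (intro Int_absorb1 subsetI) simp
    finally show ?thesis .
  qed
  then show ?thesis using True by simp
next
  case False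
  then obtain z where z: "y = 2 * m + z" by (metis le_add_diff_inverse not_less)
  have "{s \<in> {..<30 * m}. owner m s = y} = {16 * m + 7 * z..<16 * m + 7 * z + 7}"
  proof -
    have "owner m x = y \<longleftrightarrow> 16 * m + 7 * z \<le> x \<and> x < 16 * m + 7 * z + 7" for x
    proof (cases "x < 16 * m")
      case True
      then have "x div 8 < 2 * m" by (simp add: div_less_iff_less_mult)
      then show ?thesis using True z by (simp add: owner_def)
    next
      case False
      then obtain w where w: "x = 16 * m + w" by (metis le_add_diff_inverse not_less)
      have "w div 7 = z \<longleftrightarrow> 7 * z \<le> w \<and> w < 7 * z + 7" by linarith
      then show ?thesis using z w by (simp add: owner_def)
    qed
    then have "{s \<in> {..<30 * m}. owner m s = y} = {..<30 * m} \<inter> {16 * m + 7 * z..<16 * m + 7 * z + 7}"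
      by (simp add: set_eq_iff)
    also have "\<dots> = {16 * m + 7 * z..<16 * m + 7 * z + 7}"
      using assms z by (intro Int_absorb1 subsetI) simp
    finally show ?thesis .
  qed
  then show ?thesis using False by simp
qed

lemma card_owner_preimage:
  assumes "T \<subseteq> {..<4 * m}"
  shows "card {s \<in> {..<30 * m}. owner m s \<in> T} = slots m T"
proof -
  have fin: "finite T" using assms finite_subset by blast
  have "{s \<in> {..<30 * m}. owner m s \<in> T} = (\<Union>y\<in>T. {s \<in> {..<30 * m}. owner m s = y})" by auto
  also have "card \<dots> = (\<Sum>y\<in>T. card {s \<in> {..<30 * m}. owner m s = y})"
    using fin by (intro card_UN_disjoint) auto
  also have "\<dots> = (\<Sum>y\<in>T. 7 + (if y \<in> {..<2 * m} then 1 else 0))"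
  proof (rule sum.cong[OF refl])
    fix y assume "y \<in> T"
    then have "y < 4 * m" using assms by auto
    then show "card {s \<in> {..<30 * m}. owner m s = y} = 7 + (if y \<in> {..<2 * m} then 1 else 0)"
      using card_owner_fibre[of y m] by simp
  qed
  also have "\<dots> = slots m T"
    using fin by (simp only: slots_def sum.distrib sum.inter_restrict[OF fin, symmetric]) simp
  finally show ?thesis .
qed

text \<open>The bad event for \<open>T\<close>, used with \<open>card T = k\<close>. It need not
  violate Hall's condition, but every violation produces such an event, since a smaller
  neighbourhood can be enlarged to size \<open>k\<close>.\<close>

definition confined :: "nat \<Rightarrow> nat \<Rightarrow> nat set \<Rightarrow> (nat \<Rightarrow> nat) set" where
  "confined m k T = {p. p permutes {..<30 * m} \<and> (\<exists>S\<subseteq>{..<6 * m}. card S = k \<and>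
     p ` {s \<in> {..<30 * m}. s div 5 \<in> S} \<subseteq> {s \<in> {..<30 * m}. owner m s \<in> T})}"

lemma card_confined_le:
  assumes T: "T \<subseteq> {..<4 * m}" and k: "k \<le> 6 * m" and j: "j \<le> k"
  shows "real (card (confined m k T)) \<le> fact (30 * m) *
     (real (slots m T choose (5 * j)) * real (6 * m choose j) / (real (k choose j) * real (30 * m choose (5 * j))))"
proof -
  have fib: "card {s \<in> {..<30 * m}. s div 5 = x} = 5" if "x \<in> {..<6 * m}" for x
  proof -
    have "{s \<in> {..<30 * m}. s div 5 = x} = {5 * x..<5 * x + 5}" using that by auto
    then show ?thesis by simp
  qed
  have "card (confined m k T) * ((k choose j) * (card {..<30 * m} choose (5 * j)))
     \<le> fact (card {..<30 * m}) * ((card {..<6 * m} choose j)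
        * (card {s \<in> {..<30 * m}. owner m s \<in> T} choose (5 * j)))"
    unfolding confined_def
    by (rule card_permutes_confined[OF _ _ _ fib]) auto
  then have "card (confined m k T) * ((k choose j) * (30 * m choose (5 * j)))
     \<le> fact (30 * m) * ((6 * m choose j) * (slots m T choose (5 * j)))"
    by (simp only: card_owner_preimage[OF T] card_lessThan)
  then have "real (card (confined m k T) * ((k choose j) * (30 * m choose (5 * j))))
     \<le> real (fact (30 * m) * ((6 * m choose j) * (slots m T choose (5 * j))))"
    by (simp only: of_nat_le_iff)
  moreover have "0 < real (k choose j) * real (30 * m choose (5 * j))" using j k by simp
  ultimately show ?thesis by (simp add: pos_le_divide_eq mult_ac)
qed

text \<open>Union bound: the bad permutations number at most \<open>fact (30 * m)\<close> times the
  sum of the \<open>fail_bound\<close> values, hence fewer than all permutations.\<close>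

lemma exists_unconfined_permutation:
  assumes j: "\<And>k. j k \<le> k" and lt: "(\<Sum>k=1..3 * m. fail_bound m k (j k)) < 1"
  shows "\<exists>p. p permutes {..<30 * m} \<and> (\<forall>k\<in>{1..3 * m}. \<forall>T. T \<subseteq> {..<4 * m} \<and> card T = k \<longrightarrow> p \<notin> confined m k T)"
proof -
  let ?F = "\<lambda>k. {T. T \<subseteq> {..<4 * m} \<and> card T = k}"
  define bad where "bad = (\<Union>k\<in>{1..3 * m}. \<Union>T\<in>?F k. confined m k T)"
  have "card bad \<le> (\<Sum>k=1..3 * m. \<Sum>T\<in>?F k. card (confined m k T))"
    unfolding bad_def
    by (intro order_trans[OF card_UN_le] sum_mono card_UN_le) auto
  then have "real (card bad) \<le> (\<Sum>k=1..3 * m. \<Sum>T\<in>?F k. real (card (confined m k T)))"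
    by (metis (mono_tags, lifting) of_nat_le_iff of_nat_sum sum.cong)
  also have "\<dots> \<le> (\<Sum>k=1..3 * m. \<Sum>T\<in>?F k. fact (30 * m) * (real (slots m T choose (5 * j k))
      * real (6 * m choose j k) / (real (k choose j k) * real (30 * m choose (5 * j k)))))"
    using j by (intro sum_mono card_confined_le) auto
  also have "\<dots> = fact (30 * m) * (\<Sum>k=1..3 * m. fail_bound m k (j k))"
    by (simp add: fail_bound_def sum_distrib_left sum_distrib_right sum_divide_distrib)
  also have "\<dots> < fact (30 * m)" using lt by simp
  finally have "card bad < fact (30 * m)" by (metis of_nat_fact of_nat_less_iff)
  moreover have "card {p. p permutes {..<30 * m}} = fact (30 * m)"
    by (rule card_permutations) auto
  ultimately have "\<not> {p. p permutes {..<30 * m}} \<subseteq> bad"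
    using card_mono[of bad "{p. p permutes {..<30 * m}}"]
      finite_subset[of bad "{p. p permutes {..<30 * m}}"] finite_permutations[of "{..<30 * m}"]
    by (force simp: bad_def confined_def)
  then show ?thesis by (auto simp: bad_def)
qed

theorem theorem1p1:
  shows "\<exists>m0::nat. \<forall>m::nat. m \<ge> m0 \<and> m > 0 \<longrightarrow>
    (\<exists>(X :: nat set) (Y :: nat set) (E :: (nat \<times> nat) set).
       concentrator (6 * m) (4 * m) (3 * m) 5.05 X Y E)"
proof -
  obtain m0 where m0: "\<And>m. m0 \<le> m \<Longrightarrow> \<exists>j. (\<forall>k. j k \<le> k) \<and> (\<Sum>k=1..3 * m. fail_bound m k (j k)) < 1"
    using sum_fail_bound_less_1 by blast
  show ?thesis
  proof (intro exI[of _ m0] allI impI, elim conjE)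
    fix m :: nat assume m: "m0 \<le> m" "0 < m"
    define U where "U = {..<30 * m}"
    obtain p where p: "p permutes U"
      and unconf: "\<And>k T. 1 \<le> k \<Longrightarrow> k \<le> 3 * m \<Longrightarrow> T \<subseteq> {..<4 * m} \<Longrightarrow> card T = k \<Longrightarrow> p \<notin> confined m k T"
      using m0[OF m(1)] exists_unconfined_permutation[of _ m] unfolding U_def by (metis atLeastAtMost_iff)
    \<comment> \<open>Parallel edges collapse in the image, so there are at most
      \<open>30 * m\<close> edges, five per input on average.\<close>
    define E where "E = (\<lambda>s. (s div 5, owner m (p s))) ` U"
    have finU: "finite U" by (simp add: U_def)
    have pU: "p s \<in> U" if "s \<in> U" for s using p that permutes_in_image by metis
    have EXY: "E \<subseteq> {..<6 * m} \<times> {..<4 * m}"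
      using pU owner_less by (auto simp: E_def U_def)
    have "card E \<le> 30 * m" unfolding E_def using card_image_le[OF finU] by (simp add: U_def)
    then have "real (card E) \<le> real (30 * m)" by (simp only: of_nat_le_iff)
    then have cardE: "real (card E) \<le> real (6 * m) * 5.05" using m by simp
    have matching: "\<exists>M. M \<subseteq> E \<and> card M = card S \<and> fst ` M = S \<and> pairwise disjoint_edges M"
      if S: "S \<subseteq> {..<6 * m}" "card S \<le> 3 * m" for S
    proof -
      have finS: "finite S" using S finite_subset by blast
      define A where "A x = {y. (x, y) \<in> E}" for x
      have AY: "A x \<subseteq> {..<4 * m}" for x using EXY by (auto simp: A_def)
      have "\<exists>h. inj_on h S \<and> (\<forall>x\<in>S. h x \<in> A x)"
      proof (rule hall_marriage[OF finS])
        show "finite (A x)" for x using AY finite_subset by blast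
      next
        fix J assume J: "J \<subseteq> S"
        show "card J \<le> card (\<Union>(A ` J))"
        proof (rule ccontr)
          assume lt: "\<not> card J \<le> card (\<Union>(A ` J))"
          have cJ: "card J \<le> 3 * m" using J S card_mono[OF finS J] by simp
          have "\<Union>(A ` J) \<subseteq> {..<4 * m}" using AY by blast
          \<comment> \<open>The neighbourhood of \<open>J\<close> is smaller than \<open>J\<close>;
            it is enlarged to exactly \<open>card J\<close> outputs, which fits since
            \<open>card J <= 3 * m <= 4 * m\<close>.\<close>
          then obtain T where T: "\<Union>(A ` J) \<subseteq> T" "T \<subseteq> {..<4 * m}" "card T = card J"
            using exists_subset_between[of "\<Union>(A ` J)" "card J" "{..<4 * m}"] lt cJ by auto
          have "p ` {s \<in> U. s div 5 \<in> J} \<subseteq> {s \<in> U. owner m s \<in> T}"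
          proof (intro image_subsetI CollectI conjI)
            fix s assume s: "s \<in> {s \<in> U. s div 5 \<in> J}"
            then show "p s \<in> U" using pU by simp
            have "owner m (p s) \<in> A (s div 5)" using s by (auto simp: A_def E_def)
            then show "owner m (p s) \<in> T" using s T(1) by blast
          qed
          then have "p \<in> confined m (card J) T"
            using p J S(1) unfolding confined_def U_def by blast
          moreover have "1 \<le> card J" using lt by simp
          ultimately show False using unconf cJ T by blast
        qed
      qed
      then obtain h where h: "inj_on h S" "\<forall>x\<in>S. h x \<in> A x" by blast
      show ?thesis
      proof (intro exI[of _ "(\<lambda>x. (x, h x)) ` S"] conjI)
        show "(\<lambda>x. (x, h x)) ` S \<subseteq> E" using h by (auto simp: A_def)
        show "card ((\<lambda>x. (x, h x)) ` S) = card S" by (intro card_image) (simp add: inj_on_def)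
        show "fst ` (\<lambda>x. (x, h x)) ` S = S" by (simp add: image_image)
        show "pairwise disjoint_edges ((\<lambda>x. (x, h x)) ` S)"
          using h(1) by (auto simp: pairwise_def disjoint_edges_def inj_on_def)
      qed
    qed
    have "concentrator (6 * m) (4 * m) (3 * m) 5.05 {..<6 * m} {..<4 * m} E"
      unfolding concentrator_def using m EXY cardE matching by simp
    then show "\<exists>(X :: nat set) (Y :: nat set) (E :: (nat \<times> nat) set).
       concentrator (6 * m) (4 * m) (3 * m) 5.05 X Y E" by blast
  qed
qed

end
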